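(* Let $\mathfrak X$ be a $T_0$, sober topological space with a basis of quasi-compact opens. Then $\mathfrak X$ is the spectrum of a finitary covered hypersemigroup; that is, there is a finitary covered hypersemigroup $A$ such that the frame $\operatorname{Spec}A$ is isomorphic to the frame $\mathcal O(\mathfrak X)$ of open sets of $\mathfrak X$.
   Context: A binary hyperoperation on a set $A$ is a map $A\times A\to\mathcal P(A)$ (the empty set is an allowed value), extended to $\mathcal P(A)$ by $S\boxdot T=\bigcup_{s\in S,t\in T}s\boxdot t$. A hypersemigroup is a set $A$ with a binary hyperoperation $\boxdot$ with $a\boxdot(b\boxdot c)=(a\boxdot b)\boxdot c$ for all $a,b,c\in A$. A covered hypersemigroup is a hypersemigroup with a closure operator $[-]$ on $(\mathcal P(A),\subset)$ such that $[S]\boxdot[T]\subset[S\boxdot T]$ for all $S,T\subset A$. It is finitary if $[S]=\bigcup\{[S']\mid S'\subset S\text{ finite}\}$ for all $S$. A flat is a subset $C$ with $[C]=C$. A suplattice is a poset with all suprema. A quantale is a suplattice with an associative multiplication distributing over arbitrary joins in each variable. The set $\mathcal C(A)$ of flats is a quantale with joins $[\bigcup_\alpha C_\alpha]$ and product $[C\boxdot D]$. A frame is a suplattice in which binary meet distributes over arbitrary joins, regarded as a quantale with multiplication $\wedge$. A strong morphism of quantales is a map preserving arbitrary joins and products (units/top elements need not be preserved). For a quantale $\mathcal Q$, $\operatorname{Spec}\mathcal Q$ is the frame equipped with a strong morphism $\mathcal Q\to\operatorname{Spec}\mathcal Q$ initial among strong morphisms from $\mathcal Q$ to frames (this exists,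 by a theorem of Rosenthal). For a covered hypersemigroup, $\operatorname{Spec}A=\operatorname{Spec}\mathcal C(A)$. A $T_0$ sober space is identified with its frame of open sets. *)

theory Defs
  imports "HOL-Analysis.Abstract_Topological_Spaces" "HOL-Algebra.Complete_Lattice"
begin

section \<open>Suplattices, quantales and frames\<close>

locale suplattice = partial_order +
  assumes sup_exists: "S \<subseteq> carrier L \<Longrightarrow> \<exists>s. least L s (Upper L S)"

sublocale suplattice \<subseteq> complete_lattice
proof
  fix S assume S: "S \<subseteq> carrier L"
  show "\<exists>s. least L s (Upper L S)" by (rule sup_exists[OF S])
  have "Lower L S \<subseteq> carrier L" by simp
  then obtain i where i: "least L i (Upper L (Lower L S))" using sup_exists by blast
  have "greatest L i (Lower L S)"
  proof (rule greatest_LowerI)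
    show "i \<sqsubseteq> x" if "x \<in> S" for x
    proof (rule least_le[OF i])
      show "x \<in> Upper L (Lower L S)"
        using that S by (auto simp: Upper_def Lower_def)
    qed
    show "y \<sqsubseteq> i" if "y \<in> Lower L S" for y
      using least_Upper_above[OF i that] by simp
  qed (use S i in auto)
  then show "\<exists>i. greatest L i (Lower L S)" by blast
qed

record 'a multiplicative_order = "'a gorder" +
  qmult :: "'a \<Rightarrow> 'a \<Rightarrow> 'a"  (infixl \<open>\<otimes>\<index>\<close> 70)

locale quantale = suplattice Q for Q (structure) +
  assumes qmult_closed: "x \<in> carrier Q \<Longrightarrow> y \<in> carrier Q \<Longrightarrow> x \<otimes> y \<in> carrier Q"
    and qmult_assoc: "x \<in> carrier Q \<Longrightarrow> y \<in> carrier Q \<Longrightarrow> z \<in> carrier Q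
          \<Longrightarrow> (x \<otimes> y) \<otimes> z = x \<otimes> (y \<otimes> z)"
    and qmult_sup_right: "x \<in> carrier Q \<Longrightarrow> S \<subseteq> carrier Q
          \<Longrightarrow> x \<otimes> (\<Squnion>S) = \<Squnion>((\<lambda>s. x \<otimes> s) ` S)"
    and qmult_sup_left: "x \<in> carrier Q \<Longrightarrow> S \<subseteq> carrier Q
          \<Longrightarrow> (\<Squnion>S) \<otimes> x = \<Squnion>((\<lambda>s. s \<otimes> x) ` S)"

locale frame = suplattice +
  assumes meet_sup_distrib: "x \<in> carrier L \<Longrightarrow> S \<subseteq> carrier L
            \<Longrightarrow> x \<sqinter> (\<Squnion>S) = \<Squnion>((\<lambda>s. x \<sqinter> s) ` S)"

definition frame_quantale :: "'a gorder \<Rightarrow> 'a multiplicative_order" where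
  "frame_quantale L = \<lparr>carrier = carrier L, eq = eq L, le = le L, qmult = meet L\<rparr>"

text \<open>Taking \<open>S = {}\<close> below, the bottom element is preserved; nothing is required of tops or units.\<close>

definition strong_morphism ::
    "'a multiplicative_order \<Rightarrow> 'b multiplicative_order \<Rightarrow> ('a \<Rightarrow> 'b) \<Rightarrow> bool" where
  "strong_morphism Q R h \<longleftrightarrow>
     h \<in> carrier Q \<rightarrow> carrier R \<and>
     (\<forall>S. S \<subseteq> carrier Q \<longrightarrow> h (\<Squnion>\<^bsub>Q\<^esub>S) = \<Squnion>\<^bsub>R\<^esub>(h ` S)) \<and>
     (\<forall>x\<in>carrier Q. \<forall>y\<in>carrier Q. h (x \<otimes>\<^bsub>Q\<^esub> y) = h x \<otimes>\<^bsub>R\<^esub> h y)"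

definition frame_isomorphic :: "'a gorder \<Rightarrow> 'b gorder \<Rightarrow> bool" where
  "frame_isomorphic F G \<longleftrightarrow>
     (\<exists>h k. strong_morphism (frame_quantale F) (frame_quantale G) h \<and>
            strong_morphism (frame_quantale G) (frame_quantale F) k \<and>
            (\<forall>x\<in>carrier F. k (h x) = x) \<and> (\<forall>y\<in>carrier G. h (k y) = y))"


section \<open>The spectrum of a quantale\<close>

text \<open>
  \<open>\<eta>\<close> is initial among the strong morphisms from \<open>Q\<close> to frames. A definition can only quantify
  over frames carried by one type, here the type of the elements of \<open>Q\<close>. This loses
  nothing, because the image of a strong morphism from \<open>Q\<close> to a frame is again a frame and can be
  copied onto a subset of the carrier of \<open>Q\<close>: the lemma \<open>is_spectrum_universal\<close> below gives
  initiality among the strong morphisms to frames over arbitrary types. Maps are compared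
  on carriers only.
\<close>

definition is_spectrum :: "'a multiplicative_order \<Rightarrow> 'a gorder \<Rightarrow> ('a \<Rightarrow> 'a) \<Rightarrow> bool" where
  "is_spectrum Q F \<eta> \<longleftrightarrow>
     frame F \<and> strong_morphism Q (frame_quantale F) \<eta> \<and>
     (\<forall>(G :: 'a gorder) f. frame G \<and> strong_morphism Q (frame_quantale G) f \<longrightarrow>
        (\<exists>h. strong_morphism (frame_quantale F) (frame_quantale G) h \<and>
             (\<forall>x\<in>carrier Q. h (\<eta> x) = f x)) \<and>
        (\<forall>h h'. strong_morphism (frame_quantale F) (frame_quantale G) h \<and>
                (\<forall>x\<in>carrier Q. h (\<eta> x) = f x) \<and>
                strong_morphism (frame_quantale F) (frame_quantale G) h' \<and>
                (\<forall>x\<in>carrier Q. h' (\<eta> x) = f x) \<longrightarrow>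
                (\<forall>y\<in>carrier F. h y = h' y)))"

lemma frame_quantale_simps [simp]:
  "carrier (frame_quantale L) = carrier L"
  "le (frame_quantale L) = le L"
  "eq (frame_quantale L) = eq L"
  "qmult (frame_quantale L) = meet L"
  by (simp_all add: frame_quantale_def)

lemma least_Upper_frame_quantale [simp]:
  "least (frame_quantale L) x (Upper (frame_quantale L) S) \<longleftrightarrow> least L x (Upper L S)"
  by (simp add: least_def Upper_def)

lemma sup_frame_quantale [simp]: "\<Squnion>\<^bsub>frame_quantale L\<^esub>S = \<Squnion>\<^bsub>L\<^esub>S"
  by (simp add: sup_def)

lemma (in partial_order) sup_eqI:
  assumes "least L s (Upper L S)" shows "\<Squnion>S = s"
  unfolding sup_def using assms least_unique by (metis someI_ex)

lemma (in partial_order) inf_eqI: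
  assumes "greatest L s (Lower L S)" shows "\<Sqinter>S = s"
  unfolding inf_def using assms greatest_unique by (metis someI_ex)

lemma quantale_frame_quantale:
  assumes "frame L" shows "quantale (frame_quantale L)"
proof -
  interpret frame L by fact
  interpret P: partial_order "frame_quantale L"
    by unfold_locales (auto simp: eq_is_equal intro: le_antisym le_trans)
  show ?thesis
  proof
    fix S assume "S \<subseteq> carrier (frame_quantale L)"
    then show "\<exists>s. least (frame_quantale L) s (Upper (frame_quantale L) S)"
      using sup_exists by simp
  next
    fix x S assume a: "x \<in> carrier (frame_quantale L)" "S \<subseteq> carrier (frame_quantale L)"
    have "s \<sqinter>\<^bsub>L\<^esub> x = x \<sqinter>\<^bsub>L\<^esub> s" for s
      by (simp add: meet_def insert_commute)
    with a meet_sup_distrib[of x S]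
    show "\<Squnion>\<^bsub>frame_quantale L\<^esub>S \<otimes>\<^bsub>frame_quantale L\<^esub> x
            = \<Squnion>\<^bsub>frame_quantale L\<^esub>((\<lambda>s. s \<otimes>\<^bsub>frame_quantale L\<^esub> x) ` S)"
      by simp
  qed (auto simp: meet_assoc meet_sup_distrib)
qed

lemma strong_morphism_comp:
  assumes "strong_morphism P Q f" "strong_morphism Q R g"
  shows "strong_morphism P R (g \<circ> f)"
proof -
  have "f ` S \<subseteq> carrier Q" if "S \<subseteq> carrier P" for S
    using assms(1) that by (auto simp: strong_morphism_def)
  then show ?thesis
    using assms by (auto simp: strong_morphism_def image_comp Pi_iff)
qed

lemma strong_morphism_id: "strong_morphism Q Q (\<lambda>x. x)"
  by (simp add: strong_morphism_def)

lemma image_frame: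
  fixes Q :: "'a multiplicative_order" and G :: "'b gorder"
  assumes Q: "quantale Q" and G: "frame G" and f: "strong_morphism Q (frame_quantale G) f"
  defines "r \<equiv> inv_into (carrier Q) f"
  defines "G0 \<equiv> \<lparr>carrier = r ` f ` carrier Q, eq = (=), le = (\<lambda>a b. le G (f a) (f b))\<rparr>"
  shows "frame G0"
    and "strong_morphism (frame_quantale G0) (frame_quantale G) f"
    and "strong_morphism Q (frame_quantale G0) (r \<circ> f)"
    and "\<forall>x\<in>carrier Q. f (r (f x)) = f x"
    and "carrier G0 \<subseteq> carrier Q"
proof -
  interpret Q: quantale Q by fact
  interpret G: frame G by fact
  have fr: "f (r (f x)) = f x" if "x \<in> carrier Q" for x
    using that unfolding r_def by (simp add: f_inv_into_f)
  then show "\<forall>x\<in>carrier Q. f (r (f x)) = f x" by blast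
  have rQ: "r (f x) \<in> carrier Q" if "x \<in> carrier Q" for x
    using that unfolding r_def by (simp add: inv_into_into)
  have cG0: "carrier G0 = (\<lambda>x. r (f x)) ` carrier Q" by (simp add: G0_def image_image)
  have leG0: "le G0 a b \<longleftrightarrow> le G (f a) (f b)" for a b by (simp add: G0_def)
  show G0Q: "carrier G0 \<subseteq> carrier Q" using rQ by (auto simp: cG0)
  have inj: "a = b" if "a \<in> carrier G0" "b \<in> carrier G0" "f a = f b" for a b
    using that fr by (auto simp: cG0)
  have rf: "r (f a) = a" if "a \<in> carrier G0" for a using that fr by (auto simp: cG0)
  have fG: "f x \<in> carrier G" if "x \<in> carrier Q" for x
    using f that by (auto simp: strong_morphism_def)
  have fsup: "f (\<Squnion>\<^bsub>Q\<^esub>S) = \<Squnion>\<^bsub>G\<^esub>(f ` S)" if "S \<subseteq> carrier Q" for S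
    using f that by (auto simp: strong_morphism_def)
  have fmult: "f (x \<otimes>\<^bsub>Q\<^esub> y) = f x \<sqinter>\<^bsub>G\<^esub> f y" if "x \<in> carrier Q" "y \<in> carrier Q" for x y
    using f that by (auto simp: strong_morphism_def)
  have frsup: "f (r (f (\<Squnion>\<^bsub>Q\<^esub>S))) = \<Squnion>\<^bsub>G\<^esub>(f ` S)" if "S \<subseteq> carrier Q" for S
    using fr[of "\<Squnion>\<^bsub>Q\<^esub>S"] fsup[OF that] Q.sup_closed[OF that] by metis
  have frmult: "f (r (f (x \<otimes>\<^bsub>Q\<^esub> y))) = f x \<sqinter>\<^bsub>G\<^esub> f y" if "x \<in> carrier Q" "y \<in> carrier Q" for x y
    using fr[of "x \<otimes>\<^bsub>Q\<^esub> y"] fmult[OF that] Q.qmult_closed[OF that] by metis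
  have fG0: "f a \<in> carrier G" if "a \<in> carrier G0" for a using that fG G0Q by blast
  interpret P: partial_order G0
  proof
    fix x y assume "le G0 x y" "le G0 y x" and c: "x \<in> carrier G0" "y \<in> carrier G0"
    then have "f x = f y" using fG G0Q unfolding leG0 by (meson G.le_antisym subsetD)
    with c inj show "eq G0 x y" by (auto simp: G0_def)
  next
    fix x y z assume "le G0 x y" "le G0 y z" "x \<in> carrier G0" "y \<in> carrier G0" "z \<in> carrier G0"
    then show "le G0 x z" using fG G0Q unfolding leG0 by (meson G.le_trans subsetD)
  qed (use fG in \<open>auto simp: G0_def fr\<close>)
  have sup0: "least G0 (r (f (\<Squnion>\<^bsub>Q\<^esub>S))) (Upper G0 S)" if S: "S \<subseteq> carrier G0" for S
  proof -
    have SQ: "S \<subseteq> carrier Q" using S G0Q by blast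
    then have SG: "f ` S \<subseteq> carrier G" using fG by blast
    have e: "f (r (f (\<Squnion>\<^bsub>Q\<^esub>S))) = \<Squnion>\<^bsub>G\<^esub>(f ` S)" by (rule frsup[OF SQ])
    show ?thesis
    proof (rule least_UpperI)
      show "le G0 x (r (f (\<Squnion>\<^bsub>Q\<^esub>S)))" if "x \<in> S" for x
        using G.sup_upper[OF SG, of "f x"] that by (simp add: leG0 e)
      show "le G0 (r (f (\<Squnion>\<^bsub>Q\<^esub>S))) y" if "y \<in> Upper G0 S" for y
      proof -
        have "y \<in> carrier G0" "\<forall>x\<in>S. le G0 x y" using that S by (auto simp: Upper_def)
        then show ?thesis unfolding leG0 e by (intro G.sup_least[OF SG] fG0) auto
      qed
      show "r (f (\<Squnion>\<^bsub>Q\<^esub>S)) \<in> carrier G0" unfolding cG0 using Q.sup_closed[OF SQ] by (rule imageI)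
    qed (rule S)
  qed
  interpret S: suplattice G0 by unfold_locales (use sup0 in blast)
  have sup0_eq: "\<Squnion>\<^bsub>G0\<^esub>S = r (f (\<Squnion>\<^bsub>Q\<^esub>S))" if "S \<subseteq> carrier G0" for S
    using P.sup_eqI[OF sup0[OF that]] .
  have fsup0: "f (\<Squnion>\<^bsub>G0\<^esub>S) = \<Squnion>\<^bsub>G\<^esub>(f ` S)" if "S \<subseteq> carrier G0" for S
    using sup0_eq[OF that] frsup[OF subset_trans[OF that G0Q]] by metis
  have meet0: "greatest G0 (r (f (x \<otimes>\<^bsub>Q\<^esub> y))) (Lower G0 {x, y})"
    if xy: "x \<in> carrier G0" "y \<in> carrier G0" for x y
  proof -
    have q: "x \<in> carrier Q" "y \<in> carrier Q" using xy G0Q by auto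
    have e: "f (r (f (x \<otimes>\<^bsub>Q\<^esub> y))) = f x \<sqinter>\<^bsub>G\<^esub> f y"
      by (rule frmult[OF q])
    show ?thesis
    proof (rule greatest_LowerI)
      show "le G0 (r (f (x \<otimes>\<^bsub>Q\<^esub> y))) z" if "z \<in> {x, y}" for z
        using that q fG by (auto simp: leG0 e G.meet_left G.meet_right)
      show "le G0 z (r (f (x \<otimes>\<^bsub>Q\<^esub> y)))" if "z \<in> Lower G0 {x, y}" for z
        using that xy unfolding leG0 e by (intro G.meet_le fG0) (auto simp: Lower_def leG0)
      show "r (f (x \<otimes>\<^bsub>Q\<^esub> y)) \<in> carrier G0"
        unfolding cG0 using Q.qmult_closed[OF q] by (rule imageI)
    qed (use xy in simp)
  qed
  have meet0_eq: "x \<sqinter>\<^bsub>G0\<^esub> y = r (f (x \<otimes>\<^bsub>Q\<^esub> y))"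
    if "x \<in> carrier G0" "y \<in> carrier G0" for x y
    unfolding meet_def using P.inf_eqI[OF meet0[OF that]] .
  have fmeet0: "f (x \<sqinter>\<^bsub>G0\<^esub> y) = f x \<sqinter>\<^bsub>G\<^esub> f y" if "x \<in> carrier G0" "y \<in> carrier G0" for x y
    using meet0_eq[OF that] frmult[of x y] that G0Q by (metis subsetD)
  show "frame G0"
  proof
    fix x S assume x: "x \<in> carrier G0" and S: "S \<subseteq> carrier G0"
    have im: "(\<lambda>s. x \<sqinter>\<^bsub>G0\<^esub> s) ` S \<subseteq> carrier G0" using x S by auto
    have fx: "f x \<in> carrier G" "f ` S \<subseteq> carrier G" using x S fG G0Q by auto
    have "f (x \<sqinter>\<^bsub>G0\<^esub> \<Squnion>\<^bsub>G0\<^esub>S) = f x \<sqinter>\<^bsub>G\<^esub> (\<Squnion>\<^bsub>G\<^esub>(f ` S))"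
      using x S by (simp add: fmeet0 fsup0)
    also have "\<dots> = \<Squnion>\<^bsub>G\<^esub>((\<lambda>s. f x \<sqinter>\<^bsub>G\<^esub> f s) ` S)"
      using G.meet_sup_distrib[OF fx] by (simp add: image_image)
    also have "(\<lambda>s. f x \<sqinter>\<^bsub>G\<^esub> f s) ` S = f ` (\<lambda>s. x \<sqinter>\<^bsub>G0\<^esub> s) ` S"
      unfolding image_image using x S fmeet0 by (intro image_cong) auto
    also have "\<Squnion>\<^bsub>G\<^esub>(f ` (\<lambda>s. x \<sqinter>\<^bsub>G0\<^esub> s) ` S) = f (\<Squnion>\<^bsub>G0\<^esub>((\<lambda>s. x \<sqinter>\<^bsub>G0\<^esub> s) ` S))"
      using fsup0[OF im] by simp
    finally show "x \<sqinter>\<^bsub>G0\<^esub> \<Squnion>\<^bsub>G0\<^esub>S = \<Squnion>\<^bsub>G0\<^esub>((\<lambda>s. x \<sqinter>\<^bsub>G0\<^esub> s) ` S)"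
      using inj[of "x \<sqinter>\<^bsub>G0\<^esub> \<Squnion>\<^bsub>G0\<^esub>S"] S.meet_closed[OF x S.sup_closed[OF S]]
        S.sup_closed[OF im] by blast
  qed
  show "strong_morphism (frame_quantale G0) (frame_quantale G) f"
    using fG G0Q fsup0 fmeet0 by (auto simp: strong_morphism_def)
  show "strong_morphism Q (frame_quantale G0) (r \<circ> f)"
    unfolding strong_morphism_def
  proof (intro conjI allI ballI impI)
    show "r \<circ> f \<in> carrier Q \<rightarrow> carrier (frame_quantale G0)" by (auto simp: cG0)
  next
    fix S assume S: "S \<subseteq> carrier Q"
    have im: "(r \<circ> f) ` S \<subseteq> carrier G0" using S by (auto simp: cG0)
    have "f (\<Squnion>\<^bsub>G0\<^esub>((r \<circ> f) ` S)) = \<Squnion>\<^bsub>G\<^esub>(f ` (r \<circ> f) ` S)" by (rule fsup0[OF im])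
    also have "f ` (r \<circ> f) ` S = f ` S"
      unfolding image_image using S fr by (intro image_cong) auto
    also have "\<Squnion>\<^bsub>G\<^esub>(f ` S) = f (r (f (\<Squnion>\<^bsub>Q\<^esub>S)))" using frsup[OF S] by metis
    finally show "(r \<circ> f) (\<Squnion>\<^bsub>Q\<^esub>S) = \<Squnion>\<^bsub>frame_quantale G0\<^esub>((r \<circ> f) ` S)"
      using inj[of "\<Squnion>\<^bsub>G0\<^esub>((r \<circ> f) ` S)" "r (f (\<Squnion>\<^bsub>Q\<^esub>S))"] S.sup_closed[OF im]
        Q.sup_closed[OF S] by (simp add: cG0)
  next
    fix x y assume xy: "x \<in> carrier Q" "y \<in> carrier Q"
    have c: "r (f x) \<in> carrier G0" "r (f y) \<in> carrier G0" using xy by (auto simp: cG0)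
    have "f (r (f x) \<sqinter>\<^bsub>G0\<^esub> r (f y)) = f (r (f (x \<otimes>\<^bsub>Q\<^esub> y)))"
      using fmeet0[OF c] fr[OF xy(1)] fr[OF xy(2)] frmult[OF xy] by metis
    then show "(r \<circ> f) (x \<otimes>\<^bsub>Q\<^esub> y) = (r \<circ> f) x \<otimes>\<^bsub>frame_quantale G0\<^esub> (r \<circ> f) y"
      using inj[of "r (f x) \<sqinter>\<^bsub>G0\<^esub> r (f y)" "r (f (x \<otimes>\<^bsub>Q\<^esub> y))"] S.meet_closed[OF c]
        Q.qmult_closed[OF xy] by (simp add: cG0)
  qed
qed

lemma is_spectrum_ex:
  fixes Q :: "'a multiplicative_order" and G :: "'a gorder"
  assumes "is_spectrum Q F \<eta>" "frame G" "strong_morphism Q (frame_quantale G) f"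
  obtains h where "strong_morphism (frame_quantale F) (frame_quantale G) h"
    and "\<forall>x\<in>carrier Q. h (\<eta> x) = f x"
proof -
  have "\<exists>h. strong_morphism (frame_quantale F) (frame_quantale G) h \<and>
            (\<forall>x\<in>carrier Q. h (\<eta> x) = f x)"
    using assms(1)[unfolded is_spectrum_def, THEN conjunct2, THEN conjunct2,
        THEN spec[of _ G], THEN spec[of _ f]] assms(2,3) by simp
  then show thesis using that by blast
qed

lemma is_spectrum_surj:
  assumes Q: "quantale Q" and F: "is_spectrum Q F \<eta>"
  shows "\<eta> ` carrier Q = carrier F"
proof -
  have fr: "frame F" and st: "strong_morphism Q (frame_quantale F) \<eta>"
    using F by (auto simp: is_spectrum_def)
  note * = image_frame[OF Q fr st]
  from is_spectrum_ex[OF F *(1,3)] obtain k where k: "strong_morphism (frame_quantale F) (frame_quantale \<lparr>carrier = inv_into (carrier Q) \<eta> ` \<eta> ` carrier Q,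
      eq = (=), le = (\<lambda>a b. le F (\<eta> a) (\<eta> b))\<rparr>) k"
    and k\<eta>: "\<forall>x\<in>carrier Q. k (\<eta> x) = (inv_into (carrier Q) \<eta> \<circ> \<eta>) x"
    .
  have 1: "strong_morphism (frame_quantale F) (frame_quantale F) (\<eta> \<circ> k)"
    using strong_morphism_comp[OF k *(2)] .
  have 2: "\<forall>x\<in>carrier Q. (\<eta> \<circ> k) (\<eta> x) = \<eta> x" using k\<eta> *(4) by simp
  have u: "\<forall>h h'. strong_morphism (frame_quantale F) (frame_quantale F) h \<and>
                (\<forall>x\<in>carrier Q. h (\<eta> x) = \<eta> x) \<and>
                strong_morphism (frame_quantale F) (frame_quantale F) h' \<and>
                (\<forall>x\<in>carrier Q. h' (\<eta> x) = \<eta> x) \<longrightarrow>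
                (\<forall>y\<in>carrier F. h y = h' y)"
    using F[unfolded is_spectrum_def, THEN conjunct2, THEN conjunct2,
        THEN spec[of _ F], THEN spec[of _ \<eta>]] fr st by simp
  have "\<forall>y\<in>carrier F. (\<eta> \<circ> k) y = (\<lambda>x. x) y"
    by (rule u[THEN spec[of _ "\<eta> \<circ> k"], THEN spec[of _ "\<lambda>x. x"], THEN mp])
      (use 1 2 strong_morphism_id[of "frame_quantale F"] in simp)
  moreover have "k y \<in> carrier Q" if "y \<in> carrier F" for y
    using k[unfolded strong_morphism_def, THEN conjunct1, THEN Pi_mem, of y] that *(5)
    unfolding frame_quantale_simps by blast
  ultimately have "carrier F \<subseteq> \<eta> ` carrier Q"
    by (metis comp_apply image_eqI subsetI)
  moreover have "\<eta> ` carrier Q \<subseteq> carrier F" using st by (auto simp: strong_morphism_def)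
  ultimately show ?thesis by blast
qed

theorem is_spectrum_universal:
  fixes Q :: "'a multiplicative_order" and G :: "'b gorder"
  assumes Q: "quantale Q" and F: "is_spectrum Q F \<eta>"
    and G: "frame G" and f: "strong_morphism Q (frame_quantale G) f"
  shows "\<exists>h. strong_morphism (frame_quantale F) (frame_quantale G) h \<and>
             (\<forall>x\<in>carrier Q. h (\<eta> x) = f x)"
    and "\<lbrakk>\<forall>x\<in>carrier Q. h (\<eta> x) = f x; \<forall>x\<in>carrier Q. h' (\<eta> x) = f x; y \<in> carrier F\<rbrakk>
           \<Longrightarrow> h y = h' y"
proof -
  note * = image_frame[OF Q G f]
  from is_spectrum_ex[OF F *(1,3)] obtain k where k: "strong_morphism (frame_quantale F) (frame_quantale \<lparr>carrier = inv_into (carrier Q) f ` f ` carrier Q,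
      eq = (=), le = (\<lambda>a b. le G (f a) (f b))\<rparr>) k"
    and k\<eta>: "\<forall>x\<in>carrier Q. k (\<eta> x) = (inv_into (carrier Q) f \<circ> f) x"
    .
  have "strong_morphism (frame_quantale F) (frame_quantale G) (f \<circ> k)"
    using strong_morphism_comp[OF k *(2)] .
  moreover have "\<forall>x\<in>carrier Q. (f \<circ> k) (\<eta> x) = f x" using k\<eta> *(4) by simp
  ultimately show "\<exists>h. strong_morphism (frame_quantale F) (frame_quantale G) h \<and>
             (\<forall>x\<in>carrier Q. h (\<eta> x) = f x)" by blast
  show "h y = h' y" if "\<forall>x\<in>carrier Q. h (\<eta> x) = f x" "\<forall>x\<in>carrier Q. h' (\<eta> x) = f x"
    "y \<in> carrier F"
    using that is_spectrum_surj[OF Q F] by (metis imageE)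
qed


section \<open>Covered hypersemigroups\<close>

definition hyper_ext :: "('a \<Rightarrow> 'a \<Rightarrow> 'a set) \<Rightarrow> 'a set \<Rightarrow> 'a set \<Rightarrow> 'a set" where
  "hyper_ext hop S T = (\<Union>s\<in>S. \<Union>t\<in>T. hop s t)"

locale hypersemigroup =
  fixes A :: "'a set" and hop :: "'a \<Rightarrow> 'a \<Rightarrow> 'a set"
  assumes hop_closed: "a \<in> A \<Longrightarrow> b \<in> A \<Longrightarrow> hop a b \<subseteq> A"
    and hop_assoc: "a \<in> A \<Longrightarrow> b \<in> A \<Longrightarrow> c \<in> A
          \<Longrightarrow> hyper_ext hop {a} (hop b c) = hyper_ext hop (hop a b) {c}"

locale covered_hypersemigroup = hypersemigroup A hop
  for A :: "'a set" and hop :: "'a \<Rightarrow> 'a \<Rightarrow> 'a set" +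
  fixes cl :: "'a set \<Rightarrow> 'a set"
  assumes cl_closed: "S \<subseteq> A \<Longrightarrow> cl S \<subseteq> A"
    and cl_extensive: "S \<subseteq> A \<Longrightarrow> S \<subseteq> cl S"
    and cl_mono: "S \<subseteq> T \<Longrightarrow> T \<subseteq> A \<Longrightarrow> cl S \<subseteq> cl T"
    and cl_idem: "S \<subseteq> A \<Longrightarrow> cl (cl S) = cl S"
    and cl_hyper: "S \<subseteq> A \<Longrightarrow> T \<subseteq> A
          \<Longrightarrow> hyper_ext hop (cl S) (cl T) \<subseteq> cl (hyper_ext hop S T)"

locale finitary_covered_hypersemigroup = covered_hypersemigroup +
  assumes finitary: "S \<subseteq> A \<Longrightarrow> cl S = (\<Union>{cl S' |S'. S' \<subseteq> S \<and> finite S'})"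

definition flats_quantale ::
    "'a set \<Rightarrow> ('a \<Rightarrow> 'a \<Rightarrow> 'a set) \<Rightarrow> ('a set \<Rightarrow> 'a set) \<Rightarrow> 'a set multiplicative_order" where
  "flats_quantale A hop cl =
     \<lparr>carrier = {C. C \<subseteq> A \<and> cl C = C}, eq = (=), le = (\<subseteq>),
      qmult = (\<lambda>C D. cl (hyper_ext hop C D))\<rparr>"

text \<open>Joins in \<^const>\<open>flats_quantale\<close> are determined by the order; they are the closures of the
  unions.\<close>

context covered_hypersemigroup
begin

abbreviation "CA \<equiv> flats_quantale A hop cl"

lemma hyper_ext_closed: "S \<subseteq> A \<Longrightarrow> T \<subseteq> A \<Longrightarrow> hyper_ext hop S T \<subseteq> A"
  using hop_closed by (fastforce simp: hyper_ext_def)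

lemma hyper_ext_mono: "S \<subseteq> S' \<Longrightarrow> T \<subseteq> T' \<Longrightarrow> hyper_ext hop S T \<subseteq> hyper_ext hop S' T'"
  by (fastforce simp: hyper_ext_def)

lemma hyper_ext_assoc:
  assumes "S \<subseteq> A" "T \<subseteq> A" "U \<subseteq> A"
  shows "hyper_ext hop (hyper_ext hop S T) U = hyper_ext hop S (hyper_ext hop T U)"
proof -
  have "hyper_ext hop (hyper_ext hop S T) U
          = (\<Union>s\<in>S. \<Union>t\<in>T. \<Union>u\<in>U. hyper_ext hop (hop s t) {u})"
    by (fastforce simp: hyper_ext_def)
  also have "\<dots> = (\<Union>s\<in>S. \<Union>t\<in>T. \<Union>u\<in>U. hyper_ext hop {s} (hop t u))"
    using assms hop_assoc by (intro SUP_cong refl) (simp add: subset_iff)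
  also have "\<dots> = hyper_ext hop S (hyper_ext hop T U)"
    by (fastforce simp: hyper_ext_def)
  finally show ?thesis .
qed

lemma cl_hyper_cl:
  assumes "S \<subseteq> A" "T \<subseteq> A"
  shows "cl (hyper_ext hop (cl S) (cl T)) = cl (hyper_ext hop S T)"
proof (rule antisym)
  have "cl (hyper_ext hop (cl S) (cl T)) \<subseteq> cl (cl (hyper_ext hop S T))"
    using assms by (intro cl_mono cl_hyper cl_closed hyper_ext_closed)
  then show "cl (hyper_ext hop (cl S) (cl T)) \<subseteq> cl (hyper_ext hop S T)"
    using assms by (simp add: cl_idem hyper_ext_closed)
  show "cl (hyper_ext hop S T) \<subseteq> cl (hyper_ext hop (cl S) (cl T))"
    using assms by (intro cl_mono hyper_ext_mono cl_extensive hyper_ext_closed cl_closed)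
qed

lemma flats_simps:
  "carrier CA = {C. C \<subseteq> A \<and> cl C = C}"
  "eq CA = (=)" "le CA = (\<subseteq>)" "qmult CA = (\<lambda>C D. cl (hyper_ext hop C D))"
  by (simp_all add: flats_quantale_def)

lemma partial_order_flats: "partial_order CA"
  by unfold_locales (auto simp: flats_simps)

lemma least_flats:
  assumes "\<A> \<subseteq> carrier CA"
  shows "least CA (cl (\<Union>\<A>)) (Upper CA \<A>)"
proof (rule least_UpperI)
  have U: "\<Union>\<A> \<subseteq> A" using assms by (auto simp: flats_simps)
  show "\<A> \<subseteq> carrier CA" by fact
  show "cl (\<Union>\<A>) \<in> carrier CA" using U cl_closed cl_idem by (simp add: flats_simps)
  show "le CA x (cl (\<Union>\<A>))" if "x \<in> \<A>" for x
    using that cl_extensive[OF U] by (auto simp: flats_simps)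
  show "le CA (cl (\<Union>\<A>)) y" if y: "y \<in> Upper CA \<A>" for y
  proof -
    have "\<Union>\<A> \<subseteq> y" "y \<subseteq> A" "cl y = y"
      using y assms unfolding flats_simps Upper_def by blast+
    then show ?thesis using cl_mono[of "\<Union>\<A>" y] by (simp add: flats_simps)
  qed
qed

lemma sup_flats: "\<A> \<subseteq> carrier CA \<Longrightarrow> \<Squnion>\<^bsub>CA\<^esub>\<A> = cl (\<Union>\<A>)"
  using partial_order.sup_eqI[OF partial_order_flats least_flats] .

theorem quantale_flats: "quantale CA"
proof -
  interpret partial_order CA by (rule partial_order_flats)
  have cl_Union_cl: "cl (\<Union>s\<in>I. cl (g s)) = cl (\<Union>s\<in>I. g s)"
    if "\<And>s. s \<in> I \<Longrightarrow> g s \<subseteq> A" for I and g :: "'a set \<Rightarrow> 'a set"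
  proof (rule antisym)
    have g: "(\<Union>s\<in>I. g s) \<subseteq> A" using that by blast
    have "cl (g s) \<subseteq> cl (\<Union>s\<in>I. g s)" if "s \<in> I" for s
      using g that by (intro cl_mono) auto
    then have "cl (\<Union>s\<in>I. cl (g s)) \<subseteq> cl (cl (\<Union>s\<in>I. g s))"
      using g by (intro cl_mono cl_closed) auto
    then show "cl (\<Union>s\<in>I. cl (g s)) \<subseteq> cl (\<Union>s\<in>I. g s)" using g cl_idem by simp
    show "cl (\<Union>s\<in>I. g s) \<subseteq> cl (\<Union>s\<in>I. cl (g s))"
    proof (rule cl_mono)
      show "(\<Union>s\<in>I. g s) \<subseteq> (\<Union>s\<in>I. cl (g s))"
        using that by (intro UN_mono order_refl cl_extensive)
      show "(\<Union>s\<in>I. cl (g s)) \<subseteq> A"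
        using that by (intro UN_least cl_closed)
    qed
  qed
  have cA: "C \<subseteq> A" "cl C = C" if "C \<in> carrier CA" for C using that by (auto simp: flats_simps)
  have mult: "C \<otimes>\<^bsub>CA\<^esub> D \<in> carrier CA" if "C \<in> carrier CA" "D \<in> carrier CA" for C D
    using that by (simp add: flats_simps cl_closed cl_idem hyper_ext_closed)
  show ?thesis
  proof
    fix S assume "S \<subseteq> carrier CA"
    then show "\<exists>s. least CA s (Upper CA S)" using least_flats by blast
  next
    fix x y assume "x \<in> carrier CA" "y \<in> carrier CA"
    then show "x \<otimes>\<^bsub>CA\<^esub> y \<in> carrier CA" by (rule mult)
  next
    fix x y z assume "x \<in> carrier CA" "y \<in> carrier CA" "z \<in> carrier CA"
    note c = this[THEN cA(1)] and e = this[THEN cA(2)]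
    have "(x \<otimes>\<^bsub>CA\<^esub> y) \<otimes>\<^bsub>CA\<^esub> z = cl (hyper_ext hop (hyper_ext hop x y) z)"
      using cl_hyper_cl[OF hyper_ext_closed[OF c(1,2)] c(3)] e by (simp add: flats_simps)
    also have "\<dots> = x \<otimes>\<^bsub>CA\<^esub> (y \<otimes>\<^bsub>CA\<^esub> z)"
      using cl_hyper_cl[OF c(1) hyper_ext_closed[OF c(2,3)]] e c
      by (simp add: flats_simps hyper_ext_assoc)
    finally show "(x \<otimes>\<^bsub>CA\<^esub> y) \<otimes>\<^bsub>CA\<^esub> z = x \<otimes>\<^bsub>CA\<^esub> (y \<otimes>\<^bsub>CA\<^esub> z)" .
  next
    fix x S assume x: "x \<in> carrier CA" and S: "S \<subseteq> carrier CA"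
    have U: "\<Union>S \<subseteq> A" using S by (auto simp: flats_simps)
    have h: "hyper_ext hop x s \<subseteq> A" "hyper_ext hop s x \<subseteq> A" if "s \<in> S" for s
      using that U cA(1)[OF x] by (intro hyper_ext_closed; blast)+
    have im: "(\<lambda>s. x \<otimes>\<^bsub>CA\<^esub> s) ` S \<subseteq> carrier CA" "(\<lambda>s. s \<otimes>\<^bsub>CA\<^esub> x) ` S \<subseteq> carrier CA"
      using mult x S by auto
    have "x \<otimes>\<^bsub>CA\<^esub> \<Squnion>\<^bsub>CA\<^esub>S = cl (hyper_ext hop x (\<Union>S))"
      using cl_hyper_cl[OF cA(1)[OF x] U] cA[OF x] sup_flats[OF S] by (simp add: flats_simps)
    also have "hyper_ext hop x (\<Union>S) = (\<Union>s\<in>S. hyper_ext hop x s)"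
      by (fastforce simp: hyper_ext_def)
    also have "cl \<dots> = \<Squnion>\<^bsub>CA\<^esub>((\<lambda>s. x \<otimes>\<^bsub>CA\<^esub> s) ` S)"
      using cl_Union_cl[OF h(1)] sup_flats[OF im(1)] by (simp add: flats_simps)
    finally show "x \<otimes>\<^bsub>CA\<^esub> \<Squnion>\<^bsub>CA\<^esub>S = \<Squnion>\<^bsub>CA\<^esub>((\<lambda>s. x \<otimes>\<^bsub>CA\<^esub> s) ` S)" .
    have "\<Squnion>\<^bsub>CA\<^esub>S \<otimes>\<^bsub>CA\<^esub> x = cl (hyper_ext hop (\<Union>S) x)"
      using cl_hyper_cl[OF U cA(1)[OF x]] cA[OF x] sup_flats[OF S] by (simp add: flats_simps)
    also have "hyper_ext hop (\<Union>S) x = (\<Union>s\<in>S. hyper_ext hop s x)"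
      by (fastforce simp: hyper_ext_def)
    also have "cl \<dots> = \<Squnion>\<^bsub>CA\<^esub>((\<lambda>s. s \<otimes>\<^bsub>CA\<^esub> x) ` S)"
      using cl_Union_cl[OF h(2)] sup_flats[OF im(2)] by (simp add: flats_simps)
    finally show "\<Squnion>\<^bsub>CA\<^esub>S \<otimes>\<^bsub>CA\<^esub> x = \<Squnion>\<^bsub>CA\<^esub>((\<lambda>s. s \<otimes>\<^bsub>CA\<^esub> x) ` S)" .
  qed
qed

end


section \<open>Sober spaces\<close>

definition irreducible_closedin :: "'a topology \<Rightarrow> 'a set \<Rightarrow> bool" where
  "irreducible_closedin X C \<longleftrightarrow> closedin X C \<and> C \<noteq> {} \<and>
     (\<forall>D E. closedin X D \<and> closedin X E \<and> C = D \<union> E \<longrightarrow> C = D \<or> C = E)"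

text \<open>Uniqueness of the generic point is the \<open>T\<^sub>0\<close> axiom, \<^const>\<open>t0_space\<close>.\<close>

definition sober_space :: "'a topology \<Rightarrow> bool" where
  "sober_space X \<longleftrightarrow>
     (\<forall>C. irreducible_closedin X C \<longrightarrow> (\<exists>x\<in>topspace X. C = X closure_of {x}))"

definition has_compact_open_basis :: "'a topology \<Rightarrow> bool" where
  "has_compact_open_basis X \<longleftrightarrow>
     (\<exists>\<B>. (\<forall>K\<in>\<B>. openin X K \<and> compactin X K) \<and>
          openin X = arbitrary union_of (\<lambda>K. K \<in> \<B>))"

definition opens_frame :: "'a topology \<Rightarrow> 'a set gorder" where
  "opens_frame X = \<lparr>carrier = {U. openin X U}, eq = (=), le = (\<subseteq>)\<rparr>"

end

(*
  Take the quasi-compact opens as A, with K * L the set of all quasi-compact opens contained in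
  the intersection of K and L, and with a family covering every quasi-compact open inside its
  union. Quasi-compactness makes the cover finitary, and the basis condition identifies the flats
  with the opens of X. The product of two flats is then their intersection, so the quantale of
  flats is already a frame and is its own spectrum.
*)
theory Submission
  imports Defs
begin

text \<open>With meet as product, distributivity of the product over joins is the frame law. Every
  strong morphism out of \<open>Q\<close> is then its own factorization through the identity, and
  its values on the carrier are forced, which gives uniqueness. \<open>gorder.truncate\<close>
  forgets the multiplication, leaving a plain order record.\<close>

lemma is_spectrum_truncate:
  fixes Q :: "'a multiplicative_order"
  assumes "quantale Q"
    and meet: "\<And>x y. x \<in> carrier Q \<Longrightarrow> y \<in> carrier Q \<Longrightarrow> x \<otimes>\<^bsub>Q\<^esub> y = x \<sqinter>\<^bsub>Q\<^esub> y"
  shows "frame (gorder.truncate Q)" and "is_spectrum Q (gorder.truncate Q) (\<lambda>x. x)"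
proof -
  interpret Q: quantale Q by fact
  let ?F = "gorder.truncate Q"
  have F: "carrier ?F = carrier Q" "le ?F = le Q" "eq ?F = eq Q"
    by (simp_all add: gorder.truncate_def)
  \<comment> \<open>Joins and meets are chosen by \<open>SOME\<close> from the order, so they agree
    in both records once the predicates that characterize them do.\<close>
  have least: "least ?F = least Q" "Upper ?F = Upper Q"
    and greatest: "greatest ?F = greatest Q" "Lower ?F = Lower Q"
    by (simp_all add: fun_eq_iff least_def Upper_def greatest_def Lower_def F)
  have sup: "\<Squnion>\<^bsub>?F\<^esub>S = \<Squnion>\<^bsub>Q\<^esub>S" for S
    by (simp add: sup_def least)
  have meet': "x \<sqinter>\<^bsub>?F\<^esub> y = x \<sqinter>\<^bsub>Q\<^esub> y" for x y
    by (simp add: meet_def inf_def greatest)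
  interpret P: partial_order ?F
    by unfold_locales (auto simp: F Q.eq_is_equal intro: Q.le_antisym Q.le_trans)
  show fr: "frame ?F"
  proof
    fix S assume "S \<subseteq> carrier ?F"
    then show "\<exists>s. least ?F s (Upper ?F S)"
      using Q.sup_exists by (simp add: F least)
  next
    fix x S assume a: "x \<in> carrier ?F" "S \<subseteq> carrier ?F"
    then have "x \<sqinter>\<^bsub>Q\<^esub> \<Squnion>\<^bsub>Q\<^esub>S = \<Squnion>\<^bsub>Q\<^esub>((\<lambda>s. x \<otimes>\<^bsub>Q\<^esub> s) ` S)"
      using Q.qmult_sup_right[of x S] meet[of x "\<Squnion>\<^bsub>Q\<^esub>S"] by (simp add: F)
    also have "(\<lambda>s. x \<otimes>\<^bsub>Q\<^esub> s) ` S = (\<lambda>s. x \<sqinter>\<^bsub>Q\<^esub> s) ` S"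
      using a meet by (intro image_cong) (auto simp: F)
    finally show "x \<sqinter>\<^bsub>?F\<^esub> \<Squnion>\<^bsub>?F\<^esub>S = \<Squnion>\<^bsub>?F\<^esub>((\<lambda>s. x \<sqinter>\<^bsub>?F\<^esub> s) ` S)"
      by (simp add: sup meet')
  qed
  have "strong_morphism Q (frame_quantale ?F) (\<lambda>x. x)"
    using meet by (simp add: strong_morphism_def F sup meet')
  \<comment> \<open>This provides the factor \<open>h = f\<close> required by initiality.\<close>
  moreover have "strong_morphism (frame_quantale ?F) (frame_quantale G) f"
    if "strong_morphism Q (frame_quantale G) f" for f and G :: "'a gorder"
    using that meet unfolding strong_morphism_def by (simp add: F sup meet')
  ultimately show "is_spectrum Q ?F (\<lambda>x. x)"
    unfolding is_spectrum_def using fr by (auto simp: F)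
qed

text \<open>The usual argument for inverses of algebraic homomorphisms: \<open>h\<close> sends the
  join or product of \<open>k\<close>-values in \<open>Q\<close> to the one in \<open>R\<close>, and
  applying \<open>k\<close> to that equation gives the claim. The closure assumptions put the joins
  and products where \<open>k\<close> cancels \<open>h\<close>.\<close>

lemma strong_morphism_inverse:
  assumes h: "strong_morphism Q R h" and k: "k \<in> carrier R \<rightarrow> carrier Q"
    and kh: "\<And>x. x \<in> carrier Q \<Longrightarrow> k (h x) = x"
    and hk: "\<And>y. y \<in> carrier R \<Longrightarrow> h (k y) = y"
    and sup: "\<And>S. S \<subseteq> carrier Q \<Longrightarrow> \<Squnion>\<^bsub>Q\<^esub>S \<in> carrier Q"
    and mult: "\<And>x y. x \<in> carrier Q \<Longrightarrow> y \<in> carrier Q \<Longrightarrow> x \<otimes>\<^bsub>Q\<^esub> y \<in> carrier Q"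
  shows "strong_morphism R Q k"
  unfolding strong_morphism_def
proof (intro conjI allI impI ballI)
  show "k \<in> carrier R \<rightarrow> carrier Q" by fact
next
  fix S assume S: "S \<subseteq> carrier R"
  then have kS: "k ` S \<subseteq> carrier Q" using k by auto
  have "h ` k ` S = S" using S hk by (force simp: image_image)
  with h kS have "h (\<Squnion>\<^bsub>Q\<^esub>(k ` S)) = \<Squnion>\<^bsub>R\<^esub>S" unfolding strong_morphism_def by metis
  then show "k (\<Squnion>\<^bsub>R\<^esub>S) = \<Squnion>\<^bsub>Q\<^esub>(k ` S)" using kh[OF sup[OF kS]] by simp
next
  fix x y assume xy: "x \<in> carrier R" "y \<in> carrier R"
  then have k': "k x \<in> carrier Q" "k y \<in> carrier Q" using k by auto
  with h hk xy have "h (k x \<otimes>\<^bsub>Q\<^esub> k y) = x \<otimes>\<^bsub>R\<^esub> y" unfolding strong_morphism_def by metis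
  then show "k (x \<otimes>\<^bsub>R\<^esub> y) = k x \<otimes>\<^bsub>Q\<^esub> k y" using kh[OF mult[OF k']] by simp
qed

text \<open>Joins and meets are determined by the order, so a bijection monotone in both directions
  preserves them. Those of \<open>M\<close> are found as images of those of \<open>L\<close>, so
  \<open>M\<close> enters as a mere partial order.\<close>

lemma frame_isomorphic_order_iso:
  fixes L :: "'a gorder" and M :: "'b gorder"
  assumes "suplattice L" "partial_order M"
    and h: "h \<in> carrier L \<rightarrow> carrier M" and k: "k \<in> carrier M \<rightarrow> carrier L"
    and kh: "\<And>x. x \<in> carrier L \<Longrightarrow> k (h x) = x"
    and hk: "\<And>y. y \<in> carrier M \<Longrightarrow> h (k y) = y"
    and h_mono: "\<And>x y. x \<in> carrier L \<Longrightarrow> y \<in> carrier L \<Longrightarrow> x \<sqsubseteq>\<^bsub>L\<^esub> y \<Longrightarrow> h x \<sqsubseteq>\<^bsub>M\<^esub> h y"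
    and k_mono: "\<And>x y. x \<in> carrier M \<Longrightarrow> y \<in> carrier M \<Longrightarrow> x \<sqsubseteq>\<^bsub>M\<^esub> y \<Longrightarrow> k x \<sqsubseteq>\<^bsub>L\<^esub> k y"
  shows "frame_isomorphic L M"
proof -
  interpret L: suplattice L by fact
  interpret M: partial_order M by fact
  have hc: "h x \<in> carrier M" if "x \<in> carrier L" for x using h that by auto
  have kc: "k y \<in> carrier L" if "y \<in> carrier M" for y using k that by auto
  \<comment> \<open>The map \<open>h\<close> is both left and right adjoint to \<open>k\<close>; one
    half of each adjunction moves an inequality about \<open>h\<close> of a join or meet into
    \<open>L\<close>, where the universal property applies.\<close>
  have le_hI: "h x \<sqsubseteq>\<^bsub>M\<^esub> y" if "x \<in> carrier L" "y \<in> carrier M" "x \<sqsubseteq>\<^bsub>L\<^esub> k y" for x y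
    using h_mono[OF that(1) kc[OF that(2)] that(3)] hk that by simp
  have ge_hI: "y \<sqsubseteq>\<^bsub>M\<^esub> h x" if "x \<in> carrier L" "y \<in> carrier M" "k y \<sqsubseteq>\<^bsub>L\<^esub> x" for x y
    using h_mono[OF kc[OF that(2)] that(1,3)] hk that by simp
  have sup: "\<Squnion>\<^bsub>M\<^esub>(h ` S) = h (\<Squnion>\<^bsub>L\<^esub>S)" if S: "S \<subseteq> carrier L" for S
  proof (rule M.sup_eqI, rule least_UpperI)
    show "x \<sqsubseteq>\<^bsub>M\<^esub> h (\<Squnion>\<^bsub>L\<^esub>S)" if "x \<in> h ` S" for x
      using that S by (auto intro!: h_mono L.sup_upper)
    show "h (\<Squnion>\<^bsub>L\<^esub>S) \<sqsubseteq>\<^bsub>M\<^esub> y" if y: "y \<in> Upper M (h ` S)" for y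
    proof (intro le_hI L.sup_closed L.sup_least S)
      have yM: "y \<in> carrier M" using y by (simp add: Upper_def)
      then show "y \<in> carrier M" "k y \<in> carrier L" using kc by auto
      fix x assume x: "x \<in> S"
      then have xL: "x \<in> carrier L" using S by blast
      have "h x \<sqsubseteq>\<^bsub>M\<^esub> y" using y x hc[OF xL] by (auto simp: Upper_def)
      then show "x \<sqsubseteq>\<^bsub>L\<^esub> k y" using k_mono[OF hc[OF xL] yM] kh[OF xL] by simp
    qed
  qed (use S hc in auto)
  have meet: "h x \<sqinter>\<^bsub>M\<^esub> h y = h (x \<sqinter>\<^bsub>L\<^esub> y)" if xy: "x \<in> carrier L" "y \<in> carrier L" for x y
    unfolding meet_def[of M]
  proof (rule M.inf_eqI, rule greatest_LowerI)
    show "h (x \<sqinter>\<^bsub>L\<^esub> y) \<sqsubseteq>\<^bsub>M\<^esub> z" if "z \<in> {h x, h y}" for z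
      using that xy by (auto intro!: h_mono L.meet_left L.meet_right)
    show "z \<sqsubseteq>\<^bsub>M\<^esub> h (x \<sqinter>\<^bsub>L\<^esub> y)" if z: "z \<in> Lower M {h x, h y}" for z
    proof -
      have "z \<in> carrier M" "z \<sqsubseteq>\<^bsub>M\<^esub> h x" "z \<sqsubseteq>\<^bsub>M\<^esub> h y"
        using z hc xy by (auto simp: Lower_def)
      then show ?thesis
        using k_mono[of z "h x"] k_mono[of z "h y"] kh hc kc xy
        by (intro ge_hI L.meet_le) auto
    qed
  qed (use xy hc in auto)
  have 1: "strong_morphism (frame_quantale L) (frame_quantale M) h"
    using h sup meet by (simp add: strong_morphism_def)
  have "strong_morphism (frame_quantale M) (frame_quantale L) k"
    by (rule strong_morphism_inverse[OF 1]) (use k kh hk in auto)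
  with 1 kh hk show ?thesis unfolding frame_isomorphic_def by blast
qed

definition compact_opens :: "'a topology \<Rightarrow> 'a set set" where
  "compact_opens X = {K. openin X K \<and> compactin X K}"

text \<open>The intersection of two quasi-compact opens need not be quasi-compact, so it is
  represented by the family of all quasi-compact opens below it. This is what calls for a
  multivalued product.\<close>

definition compact_hop :: "'a topology \<Rightarrow> 'a set \<Rightarrow> 'a set \<Rightarrow> 'a set set" where
  "compact_hop X K L = {M \<in> compact_opens X. M \<subseteq> K \<inter> L}"

text \<open>The closure of the empty family is \<open>{{}}\<close>, because the empty set is itself
  a quasi-compact open; this least flat corresponds to the empty open set.\<close>

definition compact_cl :: "'a topology \<Rightarrow> 'a set set \<Rightarrow> 'a set set" where
  "compact_cl X S = {K \<in> compact_opens X. K \<subseteq> \<Union>S}"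

lemma compact_open_basis_point:
  assumes "has_compact_open_basis X" "openin X U" "x \<in> U"
  obtains K where "K \<in> compact_opens X" "x \<in> K" "K \<subseteq> U"
proof -
  obtain \<B> where \<B>: "\<forall>K\<in>\<B>. openin X K \<and> compactin X K"
    and op: "openin X = arbitrary union_of (\<lambda>K. K \<in> \<B>)"
    using assms(1) unfolding has_compact_open_basis_def by blast
  obtain \<U> where "\<U> \<subseteq> \<B>" "\<Union>\<U> = U"
    using assms(2) unfolding op union_of_def by blast
  then show ?thesis using that \<B> assms(3) unfolding compact_opens_def by blast
qed

lemma Union_compact_opens_below:
  assumes "has_compact_open_basis X" "openin X U"
  shows "\<Union>{K \<in> compact_opens X. K \<subseteq> U} = U"
proof
  show "U \<subseteq> \<Union>{K \<in> compact_opens X. K \<subseteq> U}"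
    using compact_open_basis_point[OF assms] by blast
qed blast

lemma compact_opens_finitary_covered_hypersemigroup:
  assumes X: "has_compact_open_basis X"
  shows "finitary_covered_hypersemigroup (compact_opens X) (compact_hop X) (compact_cl X)"
proof
  fix K L N
  show "compact_hop X K L \<subseteq> compact_opens X" by (auto simp: compact_hop_def)
  show "hyper_ext (compact_hop X) {K} (compact_hop X L N)
          = hyper_ext (compact_hop X) (compact_hop X K L) {N}" (is "?l = ?r")
  proof (intro equalityI subsetI)
    fix M assume "M \<in> ?l"
    \<comment> \<open>Both triple products consist of the quasi-compact opens inside all three
      factors. Such an \<open>M\<close> can itself serve as the intermediate factor.\<close>
    then have "M \<in> compact_hop X K L" "M \<in> compact_hop X M N"
      by (auto simp: hyper_ext_def compact_hop_def)
    then show "M \<in> ?r" unfolding hyper_ext_def by blast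
  next
    fix M assume "M \<in> ?r"
    then have "M \<in> compact_hop X L N" "M \<in> compact_hop X K M"
      by (auto simp: hyper_ext_def compact_hop_def)
    then show "M \<in> ?l" unfolding hyper_ext_def by blast
  qed
next
  fix S T assume S: "S \<subseteq> compact_opens X" and T: "T \<subseteq> compact_opens X"
  show "hyper_ext (compact_hop X) (compact_cl X S) (compact_cl X T)
          \<subseteq> compact_cl X (hyper_ext (compact_hop X) S T)"
  proof
    fix M assume "M \<in> hyper_ext (compact_hop X) (compact_cl X S) (compact_cl X T)"
    then have M: "M \<in> compact_opens X" "M \<subseteq> \<Union>S" "M \<subseteq> \<Union>T"
      by (auto simp: hyper_ext_def compact_hop_def compact_cl_def)
    \<comment> \<open>\<open>M\<close> need not lie in any single product, so it is covered point by
      point: the open set \<open>s \<inter> t\<close> around \<open>x\<close> contains a basic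
      neighbourhood \<open>N\<close>, which is a member of the product of \<open>s\<close> and
      \<open>t\<close>.\<close>
    have "x \<in> \<Union>(hyper_ext (compact_hop X) S T)" if "x \<in> M" for x
    proof -
      obtain s t where st: "s \<in> S" "t \<in> T" "x \<in> s \<inter> t" using M \<open>x \<in> M\<close> by blast
      then have "openin X (s \<inter> t)" using S T by (auto simp: compact_opens_def)
      then obtain N where "N \<in> compact_opens X" "x \<in> N" "N \<subseteq> s \<inter> t"
        using compact_open_basis_point[OF X] st(3) by metis
      then show ?thesis using st(1,2) unfolding hyper_ext_def compact_hop_def by blast
    qed
    then show "M \<in> compact_cl X (hyper_ext (compact_hop X) S T)"
      using M(1) by (auto simp: compact_cl_def)
  qed
next
  fix S assume S: "S \<subseteq> compact_opens X"
  show "compact_cl X S = \<Union>{compact_cl X S' |S'. S' \<subseteq> S \<and> finite S'}"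
  proof
    show "compact_cl X S \<subseteq> \<Union>{compact_cl X S' |S'. S' \<subseteq> S \<and> finite S'}"
    proof
      fix K assume K: "K \<in> compact_cl X S"
      then have "compactin X K" "K \<subseteq> \<Union>S" "\<forall>U\<in>S. openin X U"
        using S by (auto simp: compact_cl_def compact_opens_def)
      then obtain S' where "finite S'" "S' \<subseteq> S" "K \<subseteq> \<Union>S'"
        unfolding compactin_def by blast
      with K show "K \<in> \<Union>{compact_cl X S' |S'. S' \<subseteq> S \<and> finite S'}"
        unfolding compact_cl_def by blast
    qed
    show "\<Union>{compact_cl X S' |S'. S' \<subseteq> S \<and> finite S'} \<subseteq> compact_cl X S"
      unfolding compact_cl_def by blast
  qed
next
  fix S T :: "'a set set"
  show "compact_cl X S \<subseteq> compact_opens X" by (auto simp: compact_cl_def)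
  show "S \<subseteq> compact_cl X S" if "S \<subseteq> compact_opens X"
    using that by (auto simp: compact_cl_def)
  show "compact_cl X S \<subseteq> compact_cl X T" if "S \<subseteq> T"
    using that unfolding compact_cl_def by blast
  show "compact_cl X (compact_cl X S) = compact_cl X S" if "S \<subseteq> compact_opens X"
  proof -
    \<comment> \<open>The closure of a family depends only on its union, and closing does not change
      the union.\<close>
    have "\<Union>(compact_cl X S) = \<Union>S" using that by (auto simp: compact_cl_def)
    then show ?thesis unfolding compact_cl_def by simp
  qed
qed

theorem propositionN19:
  fixes X :: "'a topology"
  assumes "t0_space X"
    and "sober_space X"
    and "has_compact_open_basis X"
  shows "\<exists>(A :: 'a set set) hop cl F \<eta>.
           finitary_covered_hypersemigroup A hop cl \<and>
           is_spectrum (flats_quantale A hop cl) F \<eta> \<and>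
           frame_isomorphic F (opens_frame X)"
proof -
  note fin = compact_opens_finitary_covered_hypersemigroup[OF assms(3)]
  interpret finitary_covered_hypersemigroup "compact_opens X" "compact_hop X" "compact_cl X"
    by (rule fin)
  have flat: "C \<subseteq> compact_opens X" "compact_cl X C = C" if "C \<in> carrier CA" for C
    using that by (auto simp: flats_simps)
  \<comment> \<open>Flats are downward closed among the quasi-compact opens: whatever lies inside
    one member is covered by the family.\<close>
  have down: "M \<in> C" if "C \<in> carrier CA" "K \<in> C" "M \<in> compact_opens X" "M \<subseteq> K" for C K M
  proof -
    have "M \<in> compact_cl X C" using that unfolding compact_cl_def by blast
    then show ?thesis using flat(2)[OF that(1)] by simp
  qed
  interpret Q: quantale CA by (rule quantale_flats)
  have inter: "C \<inter> D \<in> carrier CA" if "C \<in> carrier CA" "D \<in> carrier CA" for C D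
    using cl_mono[of "C \<inter> D" C] cl_mono[of "C \<inter> D" D] cl_extensive[of "C \<inter> D"]
      flat[OF that(1)] flat[OF that(2)] by (auto simp: flats_simps)
  have meet: "C \<otimes>\<^bsub>CA\<^esub> D = C \<sqinter>\<^bsub>CA\<^esub> D" if C: "C \<in> carrier CA" and D: "D \<in> carrier CA" for C D
  proof -
    \<comment> \<open>Products land in both flats by downward closure; conversely \<open>K\<close>
      in both is a member of \<open>K\<close> times \<open>K\<close>. As the intersection is already
      flat, closing adds nothing.\<close>
    have "hyper_ext (compact_hop X) C D = C \<inter> D"
      using flat(1)[OF C] by (auto simp: hyper_ext_def compact_hop_def intro: down[OF C] down[OF D])
    then have "C \<otimes>\<^bsub>CA\<^esub> D = C \<inter> D"
      using flat(2)[OF inter[OF C D]] by (simp add: flats_simps)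
    also have "\<dots> = C \<sqinter>\<^bsub>CA\<^esub> D"
      unfolding meet_def using inter[OF C D] C D
      by (intro Q.inf_eqI[symmetric] greatest_LowerI) (auto simp: Lower_def flats_simps(3))
    finally show ?thesis .
  qed
  let ?F = "gorder.truncate CA"
  note spec = is_spectrum_truncate[OF quantale_flats meet]
  have F: "carrier ?F = carrier CA" "le ?F = (\<subseteq>)"
    by (simp_all add: gorder.truncate_def flats_simps(3))
  interpret O: partial_order "opens_frame X"
    by unfold_locales (auto simp: opens_frame_def)
  have "frame_isomorphic ?F (opens_frame X)"
  proof (rule frame_isomorphic_order_iso
      [where h = Union and k = "\<lambda>U. {K \<in> compact_opens X. K \<subseteq> U}"])
    show "suplattice ?F" using spec(1) by (simp add: frame_def)
    show "partial_order (opens_frame X)" ..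
    show "Union \<in> carrier ?F \<rightarrow> carrier (opens_frame X)"
    proof
      fix C assume "C \<in> carrier ?F"
      then have "C \<subseteq> compact_opens X" using flat(1) by (simp only: F)
      then have "\<forall>K\<in>C. openin X K" by (auto simp: compact_opens_def)
      then show "\<Union>C \<in> carrier (opens_frame X)" by (auto simp: opens_frame_def)
    qed
    \<comment> \<open>The basis condition makes the union of this family equal to \<open>U\<close>,
      so its closure is the family again.\<close>
    show "(\<lambda>U. {K \<in> compact_opens X. K \<subseteq> U}) \<in> carrier (opens_frame X) \<rightarrow> carrier ?F"
      using Union_compact_opens_below[OF assms(3)]
      by (auto simp: F opens_frame_def flats_simps(1) compact_cl_def)
    \<comment> \<open>The left side is the closure of \<open>C\<close>, so this is just
      flatness.\<close>
    show "{K \<in> compact_opens X. K \<subseteq> \<Union>C} = C" if "C \<in> carrier ?F" for C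
      using flat(2)[of C] that by (simp add: F compact_cl_def)
    show "\<Union>{K \<in> compact_opens X. K \<subseteq> U} = U" if "U \<in> carrier (opens_frame X)" for U
      using Union_compact_opens_below[OF assms(3)] that by (simp add: opens_frame_def)
  qed (auto simp: F opens_frame_def)
  with fin spec(2) show ?thesis by blast
qed

end
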